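(* Let $\mathcal{T}=\{(a,b)\in\mathbb{R}^2: 0\le a<b\le 1\}$ and let $H:\mathcal{T}\to\mathbb{R}$ satisfy both of the following: (i) for all $0\le a<b<c\le 1$, $\;H(a,c)=\dfrac{H(a,b)(b-a)+H(b,c)(c-b)}{c-a}$; (ii) for all $0<b<c\le 1$, $\;H(0,c)=\dfrac{H(0,b)\,b+H(b,c)(c-b)}{c}$. Then the functions $f:[0,1]\to\mathbb{R}$ for which $\mathrm{DQ}_f=H$ on $\mathcal{T}$ are exactly the functions of the form $$f(x)=\begin{cases} C, & x=0,\\ xH(0,x)+C, & x\neq 0,\end{cases}$$ where $C\in\mathbb{R}$ is a constant.
   Context: For a function $f:[0,1]\to\mathbb{R}$, the difference quotient of $f$ is the function $\mathrm{DQ}_f$ on $\mathcal{T}$ given by $\mathrm{DQ}_f(a,b)=\dfrac{f(b)-f(a)}{b-a}$. All variables and functions are real-valued. *)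

theory Defs
  imports Complex_Main "HOL-Library.FuncSet"
begin

definition \<T> :: "(real \<times> real) set" where
  "\<T> = {(a, b). 0 \<le> a \<and> a < b \<and> b \<le> 1}"

definition DQ :: "(real \<Rightarrow> real) \<Rightarrow> real \<times> real \<Rightarrow> real" where
  "DQ f = (\<lambda>(a, b). (f b - f a) / (b - a))"

end

theory Submission
  imports Defs
begin

text \<open>
  Write \<open>F(a, b) = H(a, b) (b - a)\<close>, the increment that a function with difference quotient
  \<open>H\<close> must have over \<open>[a, b]\<close>. The hypotheses say that \<open>F\<close> is additive over adjacent
  intervals, which is exactly what makes \<open>F(a, b) = F(0, b) - F(0, a)\<close> hold. Hence
  \<open>x \<mapsto> F(0, x) = x H(0, x)\<close>, extended by \<open>0\<close> at \<open>0\<close>, has difference quotient \<open>H\<close>. Conversely, a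
  function is determined by its value \<open>C\<close> at \<open>0\<close> and its increments from \<open>0\<close>, so the
  pairs \<open>(0, x)\<close> alone already force the stated formula.
\<close>

theorem corollary2:
  fixes H :: "real \<times> real \<Rightarrow> real"
  assumes "\<And>a b c. 0 \<le> a \<Longrightarrow> a < b \<Longrightarrow> b < c \<Longrightarrow> c \<le> 1 \<Longrightarrow>
      H (a, c) = (H (a, b) * (b - a) + H (b, c) * (c - b)) / (c - a)"
    and "\<And>b c. 0 < b \<Longrightarrow> b < c \<Longrightarrow> c \<le> 1 \<Longrightarrow>
      H (0, c) = (H (0, b) * b + H (b, c) * (c - b)) / c"
  shows "{f \<in> {0..1} \<rightarrow>\<^sub>E (UNIV :: real set). \<forall>p\<in>\<T>. DQ f p = H p} =
    {f. \<exists>C. f = (\<lambda>x\<in>{0..1}. if x = 0 then C else x * H (0, x) + C)}"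
proof (intro subset_antisym subsetI)
  fix f assume "f \<in> {f \<in> {0..1} \<rightarrow>\<^sub>E (UNIV :: real set). \<forall>p\<in>\<T>. DQ f p = H p}"
  then have ext: "f \<in> extensional {0..1}" and dq: "\<And>p. p \<in> \<T> \<Longrightarrow> DQ f p = H p"
    by (auto simp: PiE_def)
  have "f = (\<lambda>x\<in>{0..1}. if x = 0 then f 0 else x * H (0, x) + f 0)"
  proof (rule extensionalityI[OF ext restrict_extensional])
    fix x :: real assume x: "x \<in> {0..1}"
    show "f x = (\<lambda>x\<in>{0..1}. if x = 0 then f 0 else x * H (0, x) + f 0) x"
    proof (cases "x = 0")
      case False
      with x have "(f x - f 0) / x = H (0, x)"
        using dq[of "(0, x)"] by (simp add: \<T>_def DQ_def)
      with x False show ?thesis by (simp add: field_simps)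
    qed simp
  qed
  then show "f \<in> {f. \<exists>C. f = (\<lambda>x\<in>{0..1}. if x = 0 then C else x * H (0, x) + C)}"
    by blast
next
  fix f assume "f \<in> {f. \<exists>C. f = (\<lambda>x\<in>{0..1}. if x = 0 then C else x * H (0, x) + C)}"
  then obtain C where f: "f = (\<lambda>x\<in>{0..1}. if x = 0 then C else x * H (0, x) + C)"
    by blast
  have "DQ f (a, b) = H (a, b)" if ab: "0 \<le> a" "a < b" "b \<le> 1" for a b
  proof -
    have "f b - f a = H (a, b) * (b - a)"
    proof (cases "a = 0")
      case True
      with ab show ?thesis by (simp add: f)
    next
      case False
      with ab have "b * H (0, b) = H (0, a) * a + H (a, b) * (b - a)"
        using assms(2)[of a b] by simp
      with ab False show ?thesis by (simp add: f)
    qed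
    with ab show ?thesis by (simp add: DQ_def)
  qed
  then show "f \<in> {f \<in> {0..1} \<rightarrow>\<^sub>E (UNIV :: real set). \<forall>p\<in>\<T>. DQ f p = H p}"
    by (auto simp: \<T>_def f)
qed

end
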